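(* Let $s,t\ge 3$ be integers with $s\ne 4$ and $t\ne 4$. If $t>15\bigl(\lfloor s/2\rfloor-1\bigr)$, then $$\operatorname{gp}(C_s\boxtimes C_t)=9.$$
   Context: All graphs are finite, simple and connected. $d_G(u,v)$ is the usual shortest-path distance in $G$. A set $S\subseteq V(G)$ is a general position set of $G$ if no vertex of $S$ lies on a shortest path between two other vertices of $S$; equivalently, $d_G(u,v)\ne d_G(u,w)+d_G(w,v)$ for all pairwise distinct $u,v,w\in S$. The general position number $\operatorname{gp}(G)$ is the maximum cardinality of a general position set of $G$. The strong product $G\boxtimes H$ has vertex set $V(G)\times V(H)$; distinct vertices $(u_x,u_y)$ and $(v_x,v_y)$ are adjacent if and only if ($u_x=v_x$ and $u_yv_y\in E(H)$), or ($u_y=v_y$ and $u_xv_x\in E(G)$), or ($u_xv_x\in E(G)$ and $u_yv_y\in E(H)$). $C_n$ is the cycle on $n$ vertices. *)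

theory Defs
  imports "Graph_Theory.Graph_Theory"
begin

text \<open>
  Finite simple graphs are the library's \<^locale>\<open>pair_graph\<close>s: finite, loop-free, with a symmetric set
  of arcs, so that every undirected edge is present as its two orientations.
\<close>

text \<open>
  The distance is only meaningful for vertices joined by a path, which is always the case in a
  connected graph.
\<close>

definition gdist :: "'a pair_pre_digraph \<Rightarrow> 'a \<Rightarrow> 'a \<Rightarrow> nat" where
  "gdist G u v = (LEAST n. \<exists>p. pre_digraph.apath (with_proj G) u p v \<and> length p = n)"

definition is_shortest_path :: "'a pair_pre_digraph \<Rightarrow> 'a \<Rightarrow> ('a \<times> 'a) awalk \<Rightarrow> 'a \<Rightarrow> bool" where
  "is_shortest_path G u p v \<longleftrightarrow>
     pre_digraph.apath (with_proj G) u p v \<and> length p = gdist G u v"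

definition general_position :: "'a pair_pre_digraph \<Rightarrow> 'a set \<Rightarrow> bool" where
  "general_position G S \<longleftrightarrow> S \<subseteq> pverts G \<and>
     (\<forall>u\<in>S. \<forall>v\<in>S. \<forall>w\<in>S. u \<noteq> v \<and> w \<noteq> u \<and> w \<noteq> v \<longrightarrow>
        \<not> (\<exists>p. is_shortest_path G u p v \<and> w \<in> set (pawalk_verts u p)))"

text \<open>
  For finite \<open>G\<close> the maximum ranges over a finite nonempty set, as the empty set is in
  general position.
\<close>

definition gp_number :: "'a pair_pre_digraph \<Rightarrow> nat" where
  "gp_number G = Max (card ` {S. general_position G S})"

definition strong_product ::
    "'a pair_pre_digraph \<Rightarrow> 'b pair_pre_digraph \<Rightarrow> ('a \<times> 'b) pair_pre_digraph" where
  "strong_product G H =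
     \<lparr> pverts = pverts G \<times> pverts H,
       parcs = {((ux, uy), (vx, vy)) | ux uy vx vy.
                  (ux \<in> pverts G \<and> ux = vx \<and> (uy, vy) \<in> parcs H)
                \<or> (uy \<in> pverts H \<and> uy = vy \<and> (ux, vx) \<in> parcs G)
                \<or> ((ux, vx) \<in> parcs G \<and> (uy, vy) \<in> parcs H)} \<rparr>"

text \<open>The cycle on \<open>{0..<n}\<close>; it is the graph \<open>C\<^sub>n\<close> only for \<open>n \<ge> 3\<close>.\<close>

definition cycle_graph :: "nat \<Rightarrow> nat pair_pre_digraph" where
  "cycle_graph n =
     \<lparr> pverts = {0..<n},
       parcs = {(i, j). i < n \<and> j < n \<and> (j = (i + 1) mod n \<or> i = (j + 1) mod n)} \<rparr>"

lemma pair_graph_cycle_graph: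
  assumes "n \<ge> 3"
  shows "pair_graph (cycle_graph n)"
proof -
  have fin: "finite (parcs (cycle_graph n))"
    by (rule finite_subset[of _ "{0..<n} \<times> {0..<n}"]) (auto simp: cycle_graph_def)
  have loop: False if "i < n" "Suc i mod n = i" for i
    using that assms by (cases "i + 1 = n") auto
  show ?thesis
    using fin loop by unfold_locales
      (auto simp: cycle_graph_def symmetric_def sym_def dest: loop loop[OF _ sym])
qed

lemma pair_graph_strong_product:
  assumes "pair_graph G" and "pair_graph H"
  shows "pair_graph (strong_product G H)"
proof -
  interpret G: pair_graph G by fact
  interpret H: pair_graph H by fact
  have fin: "finite (parcs (strong_product G H))"
    by (rule finite_subset[of _ "(pverts G \<times> pverts H) \<times> (pverts G \<times> pverts H)"])
      (auto simp: strong_product_def dest: G.wellformed' H.wellformed')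
  show ?thesis
  proof (unfold_locales)
    show "finite (parcs (strong_product G H))" by (fact fin)
  next
    show "symmetric (with_proj (strong_product G H))"
      by (auto simp: strong_product_def symmetric_def sym_def
          dest: G.wellformed' H.wellformed' G.arcs_symmetric H.arcs_symmetric)
  qed (auto simp: strong_product_def
       dest: G.wellformed' H.wellformed' G.no_loops' H.no_loops')
qed

lemma strongly_connected_cycle_graph:
  assumes "n \<ge> 3"
  shows "strongly_connected (with_proj (cycle_graph n))"
proof -
  interpret C: pair_graph "cycle_graph n" using assms by (rule pair_graph_cycle_graph)
  have reach: "0 \<rightarrow>\<^sup>*\<^bsub>with_proj (cycle_graph n)\<^esub> i" if "i < n" for i
    using that
  proof (induction i)
    case 0
    then show ?case by (intro C.reachable_refl) (simp add: cycle_graph_def)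
  next
    case (Suc i)
    from Suc.prems have reach_i: "0 \<rightarrow>\<^sup>*\<^bsub>with_proj (cycle_graph n)\<^esub> i" by (intro Suc.IH) simp
    from Suc.prems have "(i, Suc i) \<in> parcs (cycle_graph n)" by (simp add: cycle_graph_def)
    then show ?case by (intro C.reachable_adj_trans[OF reach_i]) simp
  qed
  show ?thesis
    unfolding strongly_connected_def
  proof (intro conjI ballI)
    show "verts (with_proj (cycle_graph n)) \<noteq> {}" using assms by (auto simp: cycle_graph_def)
  next
    fix u v
    assume "u \<in> verts (with_proj (cycle_graph n))" "v \<in> verts (with_proj (cycle_graph n))"
    then have "u < n" "v < n" by (auto simp: cycle_graph_def)
    then show "u \<rightarrow>\<^sup>*\<^bsub>with_proj (cycle_graph n)\<^esub> v"
      using reach C.reachable_trans symmetric_reachable[OF C.sym_arcs] by blast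
  qed
qed

lemma strongly_connected_strong_product:
  assumes "pair_graph G" and "pair_graph H"
    and "strongly_connected (with_proj G)" and "strongly_connected (with_proj H)"
  shows "strongly_connected (with_proj (strong_product G H))"
proof -
  interpret G: pair_graph G by fact
  interpret H: pair_graph H by fact
  interpret P: pair_graph "strong_product G H" using assms(1,2) by (rule pair_graph_strong_product)
  have left: "(u, y) \<rightarrow>\<^sup>*\<^bsub>with_proj (strong_product G H)\<^esub> (v, y)"
    if "u \<rightarrow>\<^sup>*\<^bsub>with_proj G\<^esub> v" "y \<in> pverts H" for u v y
    using that(1)
  proof (induction rule: G.reachable_induct)
    case base
    with that(2) show ?case by (intro P.reachable_refl) (simp add: strong_product_def)
  next
    case (step x z)
    then have "((x, y), (z, y)) \<in> parcs (strong_product G H)"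
      using that(2) by (simp add: strong_product_def)
    then show ?case by (intro P.reachable_adj_trans[OF step.IH]) simp
  qed
  have right: "(x, u) \<rightarrow>\<^sup>*\<^bsub>with_proj (strong_product G H)\<^esub> (x, v)"
    if "u \<rightarrow>\<^sup>*\<^bsub>with_proj H\<^esub> v" "x \<in> pverts G" for u v x
    using that(1)
  proof (induction rule: H.reachable_induct)
    case base
    with that(2) show ?case by (intro P.reachable_refl) (simp add: strong_product_def)
  next
    case (step y z)
    then have "((x, y), (x, z)) \<in> parcs (strong_product G H)"
      using that(2) by (simp add: strong_product_def)
    then show ?case by (intro P.reachable_adj_trans[OF step.IH]) simp
  qed
  show ?thesis
    unfolding strongly_connected_def
  proof (intro conjI ballI)
    show "verts (with_proj (strong_product G H)) \<noteq> {}"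
      using assms(3,4) by (auto simp: strong_product_def strongly_connected_def)
  next
    fix a b
    assume "a \<in> verts (with_proj (strong_product G H))"
      and "b \<in> verts (with_proj (strong_product G H))"
    moreover obtain u y v z where "a = (u, y)" "b = (v, z)" by (cases a, cases b)
    ultimately have ab: "a = (u, y)" "b = (v, z)" "u \<in> pverts G" "v \<in> pverts G"
      "y \<in> pverts H" "z \<in> pverts H" by (auto simp: strong_product_def)
    then have "u \<rightarrow>\<^sup>*\<^bsub>with_proj G\<^esub> v" "y \<rightarrow>\<^sup>*\<^bsub>with_proj H\<^esub> z"
      using assms(3,4) by (auto simp: strongly_connected_def)
    then show "a \<rightarrow>\<^sup>*\<^bsub>with_proj (strong_product G H)\<^esub> b"
      using left[of u v y] right[of y z v] ab P.reachable_trans by blast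
  qed
qed

lemma (in pair_wf_digraph) apath_of_awalk_shorter:
  assumes "awalk u p v"
  shows "\<exists>q. apath u q v \<and> length q \<le> length p"
  using assms
proof (induction "length p" arbitrary: p rule: less_induct)
  case less
  show ?case
  proof (cases "distinct (pawalk_verts u p)")
    case True
    with less.prems show ?thesis by (auto simp: apath_def)
  next
    case False
    with awalk_not_distinct_decomp[OF less.prems] obtain q r s w
      where d: "p = q @ r @ s" "0 < length r" "awalk u q w" "awalk w s v" by auto
    then have "awalk u (q @ s) v" by (auto intro: awalk_appendI)
    with less.hyps[of "q @ s"] d obtain q' where "apath u q' v" "length q' \<le> length (q @ s)"
      by auto
    with d show ?thesis by (intro exI[of _ q']) auto
  qed
qed

lemma (in pair_wf_digraph) gdist_le:
  assumes "awalk u p v"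
  shows "gdist G u v \<le> length p"
proof -
  obtain q where q: "apath u q v" "length q \<le> length p"
    using apath_of_awalk_shorter[OF assms] by blast
  then have "gdist G u v \<le> length q"
    unfolding gdist_def by (intro Least_le) auto
  with q show ?thesis by simp
qed

lemma (in pair_wf_digraph) ex_shortest_path:
  assumes "u \<rightarrow>\<^sup>*\<^bsub>with_proj G\<^esub> v"
  shows "\<exists>p. is_shortest_path G u p v"
proof -
  from assms obtain p where "apath u p v" using reachable_apath by blast
  then have "\<exists>n p. apath u p v \<and> length p = n" by blast
  from LeastI_ex[OF this] show ?thesis
    unfolding is_shortest_path_def gdist_def by blast
qed

lemma general_position_iff_gdist:
  assumes "pair_graph G" and conn: "strongly_connected (with_proj G)"
  shows "general_position G S \<longleftrightarrow> S \<subseteq> pverts G \<and>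
     (\<forall>u\<in>S. \<forall>v\<in>S. \<forall>w\<in>S. u \<noteq> v \<and> w \<noteq> u \<and> w \<noteq> v \<longrightarrow>
        gdist G u v \<noteq> gdist G u w + gdist G w v)"
proof -
  interpret G: pair_graph G by fact
  have "(\<exists>p. is_shortest_path G u p v \<and> w \<in> set (pawalk_verts u p)) \<longleftrightarrow>
      gdist G u v = gdist G u w + gdist G w v" (is "?L \<longleftrightarrow> ?R")
    if V: "u \<in> pverts G" "v \<in> pverts G" "w \<in> pverts G" for u v w
  proof -
    have "u \<rightarrow>\<^sup>*\<^bsub>with_proj G\<^esub> w" "w \<rightarrow>\<^sup>*\<^bsub>with_proj G\<^esub> v"
      using conn V by (auto simp: strongly_connected_def)
    then obtain a b where "is_shortest_path G u a w" "is_shortest_path G w b v"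
      using G.ex_shortest_path by meson
    then have a: "G.awalk u a w" "length a = gdist G u w"
      and b: "G.awalk w b v" "length b = gdist G w v"
      by (auto simp: is_shortest_path_def intro: G.awalkI_apath)
    have ab: "G.awalk u (a @ b) v" using a b by (auto intro: G.awalk_appendI)
    show ?thesis
    proof
      assume ?L
      then obtain p where p: "G.awalk u p v" "length p = gdist G u v" "w \<in> set (pawalk_verts u p)"
        by (auto simp: is_shortest_path_def intro: G.awalkI_apath)
      with G.awalk_decomp[of u p v w] obtain q r
        where "p = q @ r" "G.awalk u q w" "G.awalk w r v" by auto
      with p G.gdist_le[of u q w] G.gdist_le[of w r v] G.gdist_le[OF ab] a b
      show ?R by simp
    next
      assume ?R
      with a b have len: "length (a @ b) = gdist G u v" by simp
      have "distinct (pawalk_verts u (a @ b))"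
      proof (rule ccontr)
        assume "\<not> ?thesis"
        with G.awalk_not_distinct_decomp[OF ab] obtain q r s x
          where d: "a @ b = q @ r @ s" "0 < length r" "G.awalk u q x" "G.awalk x s v" by auto
        then have "G.awalk u (q @ s) v" by (auto intro: G.awalk_appendI)
        from G.gdist_le[OF this] len have "length (a @ b) \<le> length (q @ s)" by simp
        moreover have "length (a @ b) = length (q @ s) + length r" using d(1) by simp
        ultimately show False using d(2) by simp
      qed
      with ab len have "is_shortest_path G u (a @ b) v"
        by (auto simp: is_shortest_path_def G.apath_def)
      moreover have "last (pawalk_verts u a) = w"
        using a(1) by (rule G.awalkE)
      moreover have "pawalk_verts u a \<noteq> []" by (cases a) auto
      ultimately have "w \<in> set (pawalk_verts u (a @ b))" "is_shortest_path G u (a @ b) v"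
        using G.awalk_verts_append[OF ab] last_in_set[of "pawalk_verts u a"] by auto
      then show ?L by blast
    qed
  qed
  then show ?thesis unfolding general_position_def by (meson subsetD)
qed

end

theory Submission
  imports Defs
begin

text \<open>
  The distance in the product is the maximum of the two cycle distances, so a set in general
  position is a set of points on a discrete torus with \<open>d(u,v) \<noteq> d(u,w) + d(w,v)\<close> for that maximum
  metric. Everything rests on one observation about four points that follow each other around one
  of the two cycles (\<open>no_four_dominating_arcs\<close>): the four arcs between consecutive points cannot all
  be at least as long as the distance of their ends in the other cycle. Indeed two adjacent arcs
  together fill at most half of the cycle, and along them the distances in the product are just the
  arc lengths, which add up.

  For the upper bound, suppose that there were ten points. They occupy at most ten levels of the
  cycle of length \<open>t\<close>. As \<open>t\<close> is large compared to the diameter \<open>s div 2\<close> of the short cycle, some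
  \<open>s div 2 - 1\<close> consecutive levels are free (\<open>gap_if_few_points\<close>). Cut the long cycle there and measure
  heights \<open>h\<close> from the cut. Put \<open>u\<close> below \<open>v\<close> if \<open>h v - h u\<close> is positive and at least the distance of \<open>u\<close> and
  \<open>v\<close> in the short cycle; this is the causal order of a discrete space-time. The four-point
  observation now bounds both kinds of subsets (\<open>card_le_9_if_gap\<close>). In a chain of four points the
  three arcs between consecutive points are long enough by definition of the order, and the arc
  through the cut is longer than the gap, hence at least \<open>s div 2\<close>; so chains have at most three
  points. In an antichain every two points are further apart in the short cycle than in the long one,
  so the observation, with the two cycles exchanged, bounds antichains by three as well. A finite
  set of this kind has at most \<open>3 * 3\<close> points, since peeling off minimal points splits it into three
  antichains.

  For the lower bound, three points that divide a cycle almost evenly are in general position, and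
  the product of two such triples consists of nine points. When the points in the long cycle are at
  distance at least \<open>s div 2\<close> from each other, the distance between different levels does not depend on
  the short cycle, and so the product is in general position too (\<open>no_between_torus_Times\<close>).
\<close>

section \<open>Distances in strong products of cycles\<close>

text \<open>
  A certificate that \<open>d\<close> is the distance from \<open>u\<close> which mentions single arcs only: \<open>d\<close> grows by at most
  one along an arc, and from every vertex other than \<open>u\<close> one can step back to a smaller value. Being
  local, it passes easily to products.
\<close>

definition distance_from :: "'a pair_pre_digraph \<Rightarrow> 'a \<Rightarrow> ('a \<Rightarrow> nat) \<Rightarrow> bool" where
  "distance_from G u d \<longleftrightarrow> u \<in> pverts G \<and> d u = 0 \<and>
     (\<forall>a b. (a, b) \<in> parcs G \<longrightarrow> d b \<le> d a + 1) \<and>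
     (\<forall>v \<in> pverts G. v \<noteq> u \<longrightarrow> (\<exists>a. (a, v) \<in> parcs G \<and> d a < d v))"

text \<open>
  Slow growth makes \<open>d v\<close> a lower bound for the length of every walk from \<open>u\<close>, and following the
  decreasing steps back to \<open>u\<close> yields a walk that attains it.
\<close>

lemma gdist_eq_if_distance_from:
  assumes "pair_graph G" and d: "distance_from G u d" and v: "v \<in> pverts G"
  shows "gdist G u v = d v"
proof -
  interpret G: pair_graph G by fact
  have u: "u \<in> pverts G" and d0: "d u = 0"
    and step: "(a, b) \<in> parcs G \<Longrightarrow> d b \<le> d a + 1"
    and pred: "w \<in> pverts G \<Longrightarrow> w \<noteq> u \<Longrightarrow> \<exists>a. (a, w) \<in> parcs G \<and> d a < d w" for a b w
    using d by (auto simp: distance_from_def)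
  have lower: "d y \<le> d x + length p" if "G.awalk x p y" for x p y
    using that
  proof (induction p arbitrary: x)
    case Nil
    then show ?case by (simp add: G.awalk_Nil_iff)
  next
    case (Cons e p)
    obtain a b where e: "e = (a, b)" by (cases e)
    from Cons.prems e have "x = a" "(a, b) \<in> parcs G" "G.awalk b p y"
      by (auto simp: G.awalk_Cons_iff)
    with Cons.IH[of b] step[of a b] show ?case by simp
  qed
  have upper: "\<exists>p. G.awalk u p w \<and> length p \<le> d w" if "w \<in> pverts G" for w
    using that
  proof (induction "d w" arbitrary: w rule: less_induct)
    case less
    show ?case
    proof (cases "w = u")
      case True
      then show ?thesis using u by (intro exI[of _ "[]"]) (simp add: G.awalk_Nil_iff)
    next
      case False
      then obtain a where a: "(a, w) \<in> parcs G" "d a < d w" using pred less.prems by blast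
      then have "a \<in> pverts G" using G.wellformed' by blast
      with less.hyps a obtain p where p: "G.awalk u p a" "length p \<le> d a" by blast
      have "G.awalk a [(a, w)] w" using G.arc_implies_awalk[of "(a, w)"] a(1) by simp
      with p(1) have "G.awalk u (p @ [(a, w)]) w" by (rule G.awalk_appendI)
      then show ?thesis using p(2) a(2) by (intro exI[of _ "p @ [(a, w)]"]) simp
    qed
  qed
  obtain p where p: "G.awalk u p v" "length p \<le> d v" using upper v by blast
  have le: "gdist G u v \<le> d v" using G.gdist_le[OF p(1)] p(2) by simp
  have "u \<rightarrow>\<^sup>*\<^bsub>with_proj G\<^esub> v" using p(1) by (rule G.reachable_awalkI)
  then obtain q where "is_shortest_path G u q v" using G.ex_shortest_path by blast
  then have "G.awalk u q v" "length q = gdist G u v"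
    by (auto simp: is_shortest_path_def intro: G.awalkI_apath)
  with lower[of u q v] d0 le show ?thesis by simp
qed

text \<open>
  A diagonal step moves both coordinates, so the two step-backs can be made at the same time; a
  coordinate that has already arrived stays where it is.
\<close>

lemma distance_from_strong_product:
  assumes G: "distance_from G u d" and H: "distance_from H u' d'"
  shows "distance_from (strong_product G H) (u, u') (\<lambda>(x, y). max (d x) (d' y))"
  unfolding distance_from_def
proof (intro conjI allI impI ballI)
  show "(u, u') \<in> pverts (strong_product G H)"
    using G H by (simp add: distance_from_def strong_product_def)
  show "(case (u, u') of (x, y) \<Rightarrow> max (d x) (d' y)) = 0"
    using G H by (simp add: distance_from_def)
next
  fix a b assume "(a, b) \<in> parcs (strong_product G H)"
  moreover have "\<And>x y. (x, y) \<in> parcs G \<Longrightarrow> d y \<le> d x + 1" "\<And>x y. (x, y) \<in> parcs H \<Longrightarrow> d' y \<le> d' x + 1"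
    using G H by (auto simp: distance_from_def)
  ultimately show "(case b of (x, y) \<Rightarrow> max (d x) (d' y)) \<le> (case a of (x, y) \<Rightarrow> max (d x) (d' y)) + 1"
    by (fastforce simp: strong_product_def)
next
  fix v assume v: "v \<in> pverts (strong_product G H)" "v \<noteq> (u, u')"
  obtain x y where xy: "v = (x, y)" by (cases v)
  have V: "x \<in> pverts G" "y \<in> pverts H" using v xy by (auto simp: strong_product_def)
  obtain a where a: "if x = u then a = x else (a, x) \<in> parcs G \<and> d a < d x"
    using G V unfolding distance_from_def by metis
  obtain b where b: "if y = u' then b = y else (b, y) \<in> parcs H \<and> d' b < d' y"
    using H V unfolding distance_from_def by metis
  have "((a, b), v) \<in> parcs (strong_product G H)"
    using a b v xy V by (auto simp: strong_product_def split: if_splits)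
  moreover have "max (d a) (d' b) < max (d x) (d' y)"
    using a b v xy G H by (auto simp: distance_from_def max_def split: if_splits)
  ultimately show "\<exists>a. (a, v) \<in> parcs (strong_product G H) \<and>
      (case a of (x, y) \<Rightarrow> max (d x) (d' y)) < (case v of (x, y) \<Rightarrow> max (d x) (d' y))"
    using xy by (intro exI[of _ "(a, b)"]) simp
qed

text \<open>
  The distance on the cycle with vertices \<open>{0..<n}\<close>; \<open>l\<close> is the length of the arc that avoids the edge
  from \<open>n - 1\<close> to \<open>0\<close>.
\<close>

definition cyc :: "nat \<Rightarrow> nat \<Rightarrow> nat \<Rightarrow> nat" where
  "cyc n i j = (let l = (if i \<le> j then j - i else i - j) in min l (n - l))"

lemma cyc_sym: "cyc n i j = cyc n j i"
  by (auto simp: cyc_def)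

lemma cyc_self [simp]: "cyc n i i = 0"
  by (simp add: cyc_def)

lemma cyc_triangle:
  assumes "i < n" "j < n" "l < n"
  shows "cyc n i l \<le> cyc n i j + cyc n j l"
proof -
  define g :: "nat \<Rightarrow> nat \<Rightarrow> nat" where "g x y = (if x \<le> y then y - x else x - y)" for x y
  have cyc: "cyc n x y = min (g x y) (n - g x y)" for x y
    by (simp add: cyc_def g_def Let_def)
  have le: "cyc n x y \<le> g x y" "cyc n x y \<le> n - g x y"
    and cases: "cyc n x y = g x y \<or> cyc n x y = n - g x y" for x y
    by (auto simp: cyc min_def)
  have lt: "g i j < n" "g j l < n" "g i l < n"
    using assms by (auto simp: g_def)
  have tri: "g i l \<le> g i j + g j l" "g i j \<le> g i l + g j l" "g j l \<le> g i l + g i j"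
    by (auto simp: g_def)
  have round: "g i j + g j l + g i l \<le> 2 * n"
    using assms by (auto simp: g_def)
  show ?thesis
    using le[of i l] cases[of i j] cases[of j l] lt tri round by linarith
qed

lemma cyc_pos:
  assumes "i < n" "j < n" "i \<noteq> j"
  shows "cyc n i j > 0"
  using assms by (auto simp: cyc_def Let_def min_def)

lemma cyc_eq_short_arc: "i \<le> j \<Longrightarrow> 2 * (j - i) \<le> n \<Longrightarrow> cyc n i j = j - i"
  by (simp add: cyc_def Let_def)

lemma cyc_eq_long_arc: "i \<le> j \<Longrightarrow> n \<le> 2 * (j - i) \<Longrightarrow> cyc n i j = n - (j - i)"
  by (simp add: cyc_def Let_def)

lemma cyc_le_half: "cyc n i j \<le> n div 2"
  by (auto simp: cyc_def Let_def min_def)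

lemma cyc_le_arc:
  assumes "i \<le> j"
  shows "cyc n i j \<le> j - i" and "cyc n i j \<le> n - (j - i)"
  using assms by (auto simp: cyc_def)

lemma distance_from_cycle_graph:
  assumes "n \<ge> 3" "i < n"
  shows "distance_from (cycle_graph n) i (cyc n i)"
  unfolding distance_from_def
proof (intro conjI allI impI ballI)
  fix a b assume "(a, b) \<in> parcs (cycle_graph n)"
  then have "a < n" "b < n" "b = (if Suc a = n then 0 else Suc a) \<or> a = (if Suc b = n then 0 else Suc b)"
    by (auto simp: cycle_graph_def mod_Suc split: if_splits)
  then have "a < n" "b < n" "cyc n a b \<le> 1"
    by (auto simp: cyc_def Let_def split: if_splits)
  with cyc_triangle[of i n a b] assms(2) show "cyc n i b \<le> cyc n i a + 1" by linarith
next
  fix v assume "v \<in> pverts (cycle_graph n)" "v \<noteq> i"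
  then have v: "v < n" "v \<noteq> i" by (auto simp: cycle_graph_def)
  define up where "up = (if Suc v = n then 0 else Suc v)"
  define down where "down = (if v = 0 then n - 1 else v - 1)"
  have "(up, v) \<in> parcs (cycle_graph n)" "(down, v) \<in> parcs (cycle_graph n)"
    using v assms by (auto simp: cycle_graph_def up_def down_def)
  moreover have "cyc n i up < cyc n i v \<or> cyc n i down < cyc n i v"
  proof -
    consider "i < v" "2 * (v - i) \<le> n" | "i < v" "2 * (v - i) > n"
      | "v < i" "2 * (i - v) \<le> n" | "v < i" "2 * (i - v) > n"
      using v(2) by linarith
    then show ?thesis
    proof cases
      case 1
      then have "cyc n i v = v - i" by (simp add: cyc_def Let_def)
      moreover have "i \<le> down" "down - i < v - i" using 1 by (auto simp: down_def)
      ultimately show ?thesis using cyc_le_arc(1)[of i down n] by linarith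
    next
      case 2
      then have "cyc n i v = n - (v - i)" by (simp add: cyc_def Let_def)
      moreover have "cyc n i up < n - (v - i)"
      proof (cases "Suc v = n")
        case True
        then show ?thesis
          using 2(1) cyc_le_arc(1)[of up i n] cyc_sym[of n up i] by (auto simp: up_def)
      next
        case False
        then have "up = Suc v" by (simp add: up_def)
        then show ?thesis using 2(1) v(1) cyc_le_arc(2)[of i up n] by linarith
      qed
      ultimately show ?thesis by simp
    next
      case 3
      then have "cyc n i v = i - v" by (simp add: cyc_def Let_def)
      moreover have "up = Suc v" using 3(1) assms(2) by (simp add: up_def)
      ultimately show ?thesis
        using 3(1) cyc_le_arc(1)[of up i n] cyc_sym[of n up i] by linarith
    next
      case 4
      then have "cyc n i v = n - (i - v)" by (simp add: cyc_def Let_def)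
      moreover have "cyc n i down < n - (i - v)"
      proof (cases "v = 0")
        case True
        then have "down = n - 1" by (simp add: down_def)
        then show ?thesis using 4(1) True assms(2) cyc_le_arc(1)[of i down n] by linarith
      next
        case False
        then have "down = v - 1" by (simp add: down_def)
        then show ?thesis
          using 4(1) False assms(2) cyc_le_arc(2)[of down i n] cyc_sym[of n down i] by linarith
      qed
      ultimately show ?thesis by simp
    qed
  qed
  ultimately show "\<exists>a. (a, v) \<in> parcs (cycle_graph n) \<and> cyc n i a < cyc n i v" by blast
qed (use assms in \<open>auto simp: cycle_graph_def\<close>)

definition torus_dist :: "nat \<Rightarrow> nat \<Rightarrow> nat \<times> nat \<Rightarrow> nat \<times> nat \<Rightarrow> nat" where
  "torus_dist s t p q = max (cyc s (fst p) (fst q)) (cyc t (snd p) (snd q))"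

lemma gdist_strong_product_cycle_graph:
  assumes "s \<ge> 3" "t \<ge> 3" "p \<in> {0..<s} \<times> {0..<t}" "q \<in> {0..<s} \<times> {0..<t}"
  shows "gdist (strong_product (cycle_graph s) (cycle_graph t)) p q = torus_dist s t p q"
proof -
  let ?d = "\<lambda>(x, y). max (cyc s (fst p) x) (cyc t (snd p) y)"
  have "gdist (strong_product (cycle_graph s) (cycle_graph t)) (fst p, snd p) q = ?d q"
  proof (rule gdist_eq_if_distance_from)
    show "pair_graph (strong_product (cycle_graph s) (cycle_graph t))"
      using assms(1,2) by (intro pair_graph_strong_product pair_graph_cycle_graph)
    show "distance_from (strong_product (cycle_graph s) (cycle_graph t)) (fst p, snd p) ?d"
      using assms by (intro distance_from_strong_product distance_from_cycle_graph) auto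
    show "q \<in> pverts (strong_product (cycle_graph s) (cycle_graph t))"
      using assms(4) by (simp add: strong_product_def cycle_graph_def)
  qed
  then show ?thesis by (simp add: torus_dist_def case_prod_beta)
qed

text \<open>
  General position for an arbitrary distance function, so that the cycles and their product can be
  treated alike.
\<close>

definition no_between :: "('a \<Rightarrow> 'a \<Rightarrow> nat) \<Rightarrow> 'a set \<Rightarrow> bool" where
  "no_between d S \<longleftrightarrow> (\<forall>u\<in>S. \<forall>v\<in>S. \<forall>w\<in>S. u \<noteq> v \<and> w \<noteq> u \<and> w \<noteq> v \<longrightarrow> d u v \<noteq> d u w + d w v)"

lemma no_betweenD:
  assumes "no_between d S" "u \<in> S" "v \<in> S" "w \<in> S" "u \<noteq> v" "w \<noteq> u" "w \<noteq> v"
  shows "d u v \<noteq> d u w + d w v"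
  using assms by (simp add: no_between_def)

lemma no_between_mono: "no_between d S \<Longrightarrow> T \<subseteq> S \<Longrightarrow> no_between d T"
  unfolding no_between_def by blast

lemma general_position_torus_iff:
  assumes "s \<ge> 3" "t \<ge> 3"
  shows "general_position (strong_product (cycle_graph s) (cycle_graph t)) S \<longleftrightarrow>
    S \<subseteq> {0..<s} \<times> {0..<t} \<and> no_between (torus_dist s t) S"
proof -
  have V: "pverts (strong_product (cycle_graph s) (cycle_graph t)) = {0..<s} \<times> {0..<t}"
    by (simp add: strong_product_def cycle_graph_def)
  have G: "pair_graph (strong_product (cycle_graph s) (cycle_graph t))"
    and C: "strongly_connected (with_proj (strong_product (cycle_graph s) (cycle_graph t)))"
    using assms by (auto intro!: pair_graph_strong_product pair_graph_cycle_graph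
        strongly_connected_strong_product strongly_connected_cycle_graph)
  show ?thesis
    unfolding general_position_iff_gdist[OF G C] V no_between_def
    using gdist_strong_product_cycle_graph[OF assms] by (smt (verit) subsetD)
qed

section \<open>Four points around a cycle\<close>

text \<open>
  The positions \<open>f\<close> on a cycle of length \<open>n\<close> give one coordinate of the metric, \<open>e\<close> is the other. The
  arcs from \<open>a\<close> to \<open>c\<close> through \<open>b\<close> and from \<open>c\<close> to \<open>a\<close> through \<open>d\<close> make up the whole cycle, so one of them
  is at most half of it. There the cycle distances equal arc lengths and add up, and by the triangle
  inequality \<open>e\<close> stays below them, so that the middle point lies between the other two.
\<close>

lemma no_four_dominating_arcs:
  fixes f :: "'a \<Rightarrow> nat" and e :: "'a \<Rightarrow> 'a \<Rightarrow> nat"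
  assumes S: "no_between (\<lambda>u v. max (cyc n (f u) (f v)) (e u v)) S"
    and tri: "\<And>u v w. u \<in> S \<Longrightarrow> v \<in> S \<Longrightarrow> w \<in> S \<Longrightarrow> e u w \<le> e u v + e v w"
    and mem: "a \<in> S" "b \<in> S" "c \<in> S" "d \<in> S"
    and ord: "f a < f b" "f b < f c" "f c < f d" "f d < n"
    and arcs: "e a b \<le> f b - f a" "e b c \<le> f c - f b" "e c d \<le> f d - f c" "e d a \<le> n - (f d - f a)"
  shows False
proof (cases "2 * (f c - f a) \<le> n")
  \<comment> \<open>the half through \<open>b\<close>\<close>
  case True
  have "cyc n (f a) (f b) = f b - f a" "cyc n (f b) (f c) = f c - f b" "cyc n (f a) (f c) = f c - f a"
    using True ord by (auto simp: cyc_def Let_def)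
  moreover have "e a c \<le> f c - f a" using tri[of a b c] mem arcs ord by linarith
  moreover have "a \<noteq> c" "b \<noteq> a" "b \<noteq> c" using ord by auto
  ultimately show False
    using no_betweenD[OF S, of a c b] mem arcs ord by (simp add: max_def)
next
  \<comment> \<open>the half through \<open>d\<close>, across the origin of the coordinate\<close>
  case False
  have "cyc n (f c) (f d) = f d - f c" "cyc n (f d) (f a) = n - (f d - f a)"
    "cyc n (f c) (f a) = n - (f c - f a)"
    using False ord by (auto simp: cyc_def Let_def)
  moreover have "e c a \<le> n - (f c - f a)" using tri[of c d a] mem arcs ord by linarith
  moreover have "c \<noteq> a" "d \<noteq> c" "d \<noteq> a" using ord by auto
  ultimately show False
    using no_betweenD[OF S, of c a d] mem arcs ord by (simp add: max_def)
qed

lemma four_increasing_if_card_ge: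
  fixes A :: "nat set"
  assumes "card A \<ge> 4"
  shows "\<exists>a b c d. {a, b, c, d} \<subseteq> A \<and> a < b \<and> b < c \<and> c < d"
proof -
  have fin: "finite A" using assms card.infinite by fastforce
  let ?xs = "sorted_list_of_set A"
  have s: "sorted_wrt (<) ?xs" and len: "length ?xs \<ge> 4" and set: "set ?xs = A"
    using assms fin by auto
  have "?xs ! i \<in> A" if "i < 4" for i using that len set nth_mem[of i ?xs] by simp
  moreover have "?xs ! i < ?xs ! j" if "i < j" "j < 4" for i j
    using sorted_wrt_nth_less[OF s that(1)] that len by simp
  ultimately show ?thesis
    by (intro exI[of _ "?xs ! 0"] exI[of _ "?xs ! 1"] exI[of _ "?xs ! 2"] exI[of _ "?xs ! 3"]) auto
qed

text \<open>
  When the cycle coordinate strictly dominates for every pair, the points have different positions,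
  and any four of them, in the order of their positions, would contradict the previous lemma.
\<close>

lemma card_le_3_if_dominating:
  fixes f :: "'a \<Rightarrow> nat" and e :: "'a \<Rightarrow> 'a \<Rightarrow> nat"
  assumes S: "no_between (\<lambda>u v. max (cyc n (f u) (f v)) (e u v)) S"
    and tri: "\<And>u v w. u \<in> S \<Longrightarrow> v \<in> S \<Longrightarrow> w \<in> S \<Longrightarrow> e u w \<le> e u v + e v w"
    and range: "\<And>u. u \<in> S \<Longrightarrow> f u < n"
    and dom: "\<And>u v. u \<in> S \<Longrightarrow> v \<in> S \<Longrightarrow> u \<noteq> v \<Longrightarrow> e u v < cyc n (f u) (f v)"
  shows "card S \<le> 3"
proof (rule ccontr)
  assume "\<not> card S \<le> 3"
  moreover have "inj_on f S" using dom by (intro inj_onI) fastforce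
  ultimately have "card (f ` S) \<ge> 4" by (simp add: card_image)
  from four_increasing_if_card_ge[OF this] obtain a b c d
    where mem: "a \<in> S" "b \<in> S" "c \<in> S" "d \<in> S" and ord: "f a < f b" "f b < f c" "f c < f d"
    by auto
  have "e u v \<le> f v - f u" "e v u \<le> n - (f v - f u)" if "u \<in> S" "v \<in> S" "f u < f v" for u v
    using dom[of u v] dom[of v u] that cyc_le_arc[of "f u" "f v" n] cyc_sym[of n "f v" "f u"]
    by fastforce+
  with no_four_dominating_arcs[OF S tri mem ord] range mem ord show False by simp
qed

section \<open>Antichains and chains\<close>

text \<open>
  The bound behind Mirsky's theorem, with paths instead of chains so that transitivity never
  enters: the elements without predecessor form an antichain, and every path among the remaining
  elements can be extended downwards, so that removing that antichain lowers the height.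
\<close>

lemma card_le_if_bounded_antichains_chains:
  fixes R :: "'a \<Rightarrow> 'a \<Rightarrow> bool"
  assumes "finite A"
    and "\<And>B. B \<subseteq> A \<Longrightarrow> (\<And>x y. x \<in> B \<Longrightarrow> y \<in> B \<Longrightarrow> \<not> R x y) \<Longrightarrow> card B \<le> m"
    and "\<And>xs. set xs \<subseteq> A \<Longrightarrow> successively R xs \<Longrightarrow> length xs \<noteq> Suc n"
  shows "card A \<le> n * m"
  using assms
proof (induction n arbitrary: A)
  case 0
  have "A = {}"
  proof (rule ccontr)
    assume "A \<noteq> {}"
    then obtain x where "x \<in> A" by blast
    with "0.prems"(3)[of "[x]"] show False by simp
  qed
  then show ?case by simp
next
  case (Suc n)
  define M where "M = {x \<in> A. \<forall>y \<in> A. \<not> R y x}"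
  have "card M \<le> m" by (rule Suc.prems(2)) (auto simp: M_def)
  moreover have "card (A - M) \<le> n * m"
  proof (rule Suc.IH)
    show "finite (A - M)" using Suc.prems(1) by simp
    show "card B \<le> m" if "B \<subseteq> A - M" "\<And>x y. x \<in> B \<Longrightarrow> y \<in> B \<Longrightarrow> \<not> R x y" for B
      using that by (intro Suc.prems(2)) auto
    show "length xs \<noteq> Suc n" if xs: "set xs \<subseteq> A - M" "successively R xs" for xs
    proof
      assume len: "length xs = Suc n"
      then obtain z zs where z: "xs = z # zs" by (cases xs) auto
      then obtain y where "y \<in> A" "R y z" using xs by (auto simp: M_def)
      with Suc.prems(3)[of "y # xs"] xs z len show False by auto
    qed
  qed
  moreover have "card A = card M + card (A - M)"
    using Suc.prems(1) by (metis (no_types, lifting) M_def card_Diff_subset card_mono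
        finite_subset le_add_diff_inverse mem_Collect_eq subsetI)
  ultimately show ?case by simp
qed

section \<open>Cutting the long cycle\<close>

text \<open>
The position of \<open>i\<close> on a cycle of length \<open>n\<close> when positions are counted upwards from \<open>z\<close>.
\<close>

definition rot :: "nat \<Rightarrow> nat \<Rightarrow> nat \<Rightarrow> nat" where
  "rot n z i = (if z \<le> i then i - z else i + n - z)"

lemma rot_less: "z < n \<Longrightarrow> i < n \<Longrightarrow> rot n z i < n"
  by (auto simp: rot_def)

lemma rot_inj: "z < n \<Longrightarrow> i < n \<Longrightarrow> j < n \<Longrightarrow> rot n z i = rot n z j \<Longrightarrow> i = j"
  by (auto simp: rot_def split: if_splits)

lemma cyc_rot:
  assumes "z < n" "i < n" "j < n"
  shows "cyc n (rot n z i) (rot n z j) = cyc n i j"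
proof -
  define g :: "nat \<Rightarrow> nat \<Rightarrow> nat" where "g x y = (if x \<le> y then y - x else x - y)" for x y
  have cyc: "cyc n x y = min (g x y) (n - g x y)" for x y
    by (simp add: cyc_def g_def Let_def)
  have "g (rot n z i) (rot n z j) = g i j \<or> g (rot n z i) (rot n z j) = n - g i j"
    using assms unfolding rot_def g_def by (cases "z \<le> i"; cases "z \<le> j"; simp; linarith)
  moreover have "g i j \<le> n" using assms by (auto simp: g_def)
  ultimately show ?thesis unfolding cyc by (elim disjE) (simp_all add: min.commute)
qed

text \<open>
  Each point blocks only the \<open>k\<close> positions that follow it, so some \<open>z\<close> is not blocked. This says that
  the \<open>k\<close> positions preceding \<open>z\<close> are free, and these are the last ones when counting from \<open>z\<close>.
\<close>

lemma gap_if_few_points: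
  assumes "Y \<subseteq> {..<n}" "card Y * k < n"
  shows "\<exists>z<n. \<forall>y\<in>Y. rot n z y + k < n"
proof -
  define U where "U = (\<lambda>(y, j). (y + j) mod n) ` (Y \<times> {1..k})"
  have fin: "finite Y" using assms(1) finite_subset by blast
  have "card U \<le> card (Y \<times> {1..k})"
    unfolding U_def using fin by (intro card_image_le) simp
  also have "\<dots> < n" using assms(2) by (simp add: card_cartesian_product)
  finally have "\<not> {..<n} \<subseteq> U"
    using card_mono[of U "{..<n}"] fin by (auto simp: U_def)
  then obtain z where z: "z < n" "z \<notin> U" by auto
  have "rot n z y + k < n" if y: "y \<in> Y" for y
  proof (rule ccontr)
    assume far: "\<not> ?thesis"
    define j where "j = n - rot n z y"
    have yn: "y < n" using y assms(1) by auto
    have "j \<in> {1..k}" using far rot_less[OF z(1) yn] by (auto simp: j_def)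
    moreover have "(y + j) mod n = z"
      using z(1) yn by (auto simp: j_def rot_def mod_if split: if_splits)
    ultimately show False using z(2) y by (force simp: U_def)
  qed
  with z(1) show ?thesis by blast
qed

text \<open>
  The heart of the upper bound. With the cut placed at a gap of \<open>s div 2 - 1\<close> free levels, the relation
  \<open>R\<close> in the proof is the causal order on the cut torus: the four-point lemma bounds its chains via the long
  cycle and its antichains via the short one.
\<close>

lemma card_le_9_if_gap:
  assumes T: "finite T" "T \<subseteq> {0..<s} \<times> {0..<t}" "no_between (torus_dist s t) T"
    and z: "z < t" "\<And>p. p \<in> T \<Longrightarrow> rot t z (snd p) + (s div 2 - 1) < t"
  shows "card T \<le> 9"
proof -
  define g where "g p = rot t z (snd p)" for p :: "nat \<times> nat"
  define e where "e p q = cyc s (fst p) (fst q)" for p q :: "nat \<times> nat"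
  define R where "R p q \<longleftrightarrow> g p < g q \<and> e p q \<le> g q - g p" for p q
  have bounds: "fst p < s" "snd p < t" "g p < t" if "p \<in> T" for p
    using that T(2) z(1) rot_less by (auto simp: g_def)
  have g: "cyc t (g p) (g q) = cyc t (snd p) (snd q)" if "p \<in> T" "q \<in> T" for p q
    using that bounds z(1) cyc_rot by (simp add: g_def)
  have ng: "no_between (\<lambda>p q. max (cyc t (g p) (g q)) (e p q)) T"
    and ne: "no_between (\<lambda>p q. max (cyc s (fst p) (fst q)) (cyc t (g p) (g q))) T"
    using T(3) g unfolding no_between_def torus_dist_def e_def by (simp_all add: max.commute)
  have "card T \<le> 3 * 3"
  proof (rule card_le_if_bounded_antichains_chains[where R = R])
    show "finite T" by fact
  next
    fix B assume B: "B \<subseteq> T" and anti: "\<And>p q. p \<in> B \<Longrightarrow> q \<in> B \<Longrightarrow> \<not> R p q"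
    show "card B \<le> 3"
    proof (rule card_le_3_if_dominating[where f = fst and n = s and e = "\<lambda>p q. cyc t (g p) (g q)"])
      show "no_between (\<lambda>p q. max (cyc s (fst p) (fst q)) (cyc t (g p) (g q))) B"
        using ne B by (rule no_between_mono)
      show "cyc t (g p) (g r) \<le> cyc t (g p) (g q) + cyc t (g q) (g r)"
        if "p \<in> B" "q \<in> B" "r \<in> B" for p q r
        using that B by (intro cyc_triangle bounds) auto
      show "fst p < s" if "p \<in> B" for p using that B bounds by blast
      show "cyc t (g p) (g q) < cyc s (fst p) (fst q)" if pq: "p \<in> B" "q \<in> B" "p \<noteq> q" for p q
        \<comment> \<open>points on one level are unrelated, but differ in the short cycle\<close>
      proof (cases "g p = g q")
        case True
        have mem: "p \<in> T" "q \<in> T" using pq B by auto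
        have "snd p = snd q"
          using True rot_inj[OF z(1) bounds(2)[OF mem(1)] bounds(2)[OF mem(2)]] by (simp add: g_def)
        with pq have "fst p \<noteq> fst q" by (simp add: prod_eq_iff)
        with True show ?thesis using cyc_pos bounds mem by simp
      next
        case False
        then show ?thesis
          using anti[of p q] anti[of q p] pq cyc_le_arc(1)[of "g p" "g q" t]
            cyc_le_arc(1)[of "g q" "g p" t] cyc_sym[of t "g q" "g p"] cyc_sym[of s "fst q" "fst p"]
          unfolding R_def e_def by linarith
      qed
    qed
  next
    fix ps assume ps: "set ps \<subseteq> T" "successively R ps"
    show "length ps \<noteq> Suc 3"
    proof
      assume "length ps = Suc 3"
      then obtain a b c d where abcd: "ps = [a, b, c, d]"
        by (auto simp: numeral_3_eq_3 length_Suc_conv)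
      then have mem: "a \<in> T" "b \<in> T" "c \<in> T" "d \<in> T" and R: "R a b" "R b c" "R c d"
        using ps by auto
      \<comment> \<open>the arc from the top point to the bottom point crosses the gap, so it has length at least
        \<open>s div 2\<close>, which no distance in the short cycle exceeds\<close>
      have "e d a \<le> t - (g d - g a)"
        using cyc_le_half[of s "fst d" "fst a"] z(2)[OF mem(4)] R unfolding R_def e_def g_def
        by linarith
      moreover have "e p r \<le> e p q + e q r" if "p \<in> T" "q \<in> T" "r \<in> T" for p q r
        unfolding e_def using that bounds by (intro cyc_triangle) auto
      ultimately show False
        using no_four_dominating_arcs[OF ng _ mem] R bounds(3)[OF mem(4)] by (simp add: R_def)
    qed
  qed
  then show ?thesis by simp
qed

text \<open>
  Passing to a subset of exactly ten points keeps the number of occupied levels small enough for a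
  gap to exist.
\<close>

lemma card_le_9_if_no_between:
  assumes S: "S \<subseteq> {0..<s} \<times> {0..<t}" "no_between (torus_dist s t) S"
    and t: "t > 10 * (s div 2 - 1)"
  shows "card S \<le> 9"
proof (rule ccontr)
  assume "\<not> card S \<le> 9"
  then obtain T where T: "T \<subseteq> S" "card T = 10" "finite T"
    using obtain_subset_with_card_n[of 10 S] by auto
  have "card (snd ` T) * (s div 2 - 1) \<le> 10 * (s div 2 - 1)"
    using card_image_le[OF T(3), of snd] T(2) by (intro mult_le_mono1) simp
  then have few: "card (snd ` T) * (s div 2 - 1) < t" using t by (rule le_less_trans)
  have "snd ` T \<subseteq> {..<t}" using T(1) S(1) by auto
  from gap_if_few_points[OF this few] obtain z
    where z: "z < t" "\<And>p. p \<in> T \<Longrightarrow> rot t z (snd p) + (s div 2 - 1) < t" by blast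
  have "card T \<le> 9"
    by (rule card_le_9_if_gap[OF T(3) _ no_between_mono[OF S(2) T(1)] z]) (use T(1) S(1) in blast)
  with T(2) show False by simp
qed

section \<open>Nine points in general position\<close>

text \<open>
  The conditions say that none of the arcs from \<open>0\<close> to \<open>a\<close>, from \<open>a\<close> to \<open>b\<close> and from \<open>b\<close> back to \<open>0\<close>
  exceeds half of the cycle.
\<close>

lemma cyc_three_short_arcs:
  assumes "2 * a \<le> n" "a \<le> b" "2 * b \<le> n + 2 * a" "n \<le> 2 * b"
  shows "cyc n 0 a = a" "cyc n a b = b - a" "cyc n 0 b = n - b"
  using assms cyc_eq_short_arc[of 0 a n] cyc_eq_short_arc[of a b n] cyc_eq_long_arc[of 0 b n]
  by simp_all

text \<open>
  The three distances add up to \<open>n\<close> and each is less than \<open>n / 2\<close>, so none is the sum of the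
  other two.
\<close>

lemma no_between_three_short_arcs:
  assumes "0 < a" "2 * a < n" "a < b" "2 * b < n + 2 * a" "b < n" "n < 2 * b"
  shows "no_between (cyc n) {0, a, b}"
proof -
  have "cyc n 0 a = a" "cyc n a b = b - a" "cyc n 0 b = n - b"
    using assms by (simp_all add: cyc_three_short_arcs[of a n b])
  moreover from this have "cyc n a 0 = a" "cyc n b a = b - a" "cyc n b 0 = n - b"
    by (simp_all add: cyc_sym[of n a 0] cyc_sym[of n b])
  moreover have "a \<noteq> n - a" "n - b \<noteq> b" "b - a \<noteq> a + n - b" "b - a \<noteq> n + a - b"
    using assms by linarith+
  ultimately show ?thesis
    using assms unfolding no_between_def by simp
qed

definition thirds :: "nat \<Rightarrow> nat set" where
  "thirds n = {0, n div 3, 2 * n div 3}"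

text \<open>
  Replacing the quotients by plain numbers with linear constraints lets linear arithmetic finish the
  later proofs. All arcs are at least \<open>n div 3\<close> long, and less than half of the cycle; for \<open>n = 4\<close>
  the arcs would be \<open>1, 1, 2\<close>, the last of which is half of the cycle.
\<close>

lemma thirds_cases:
  assumes "n \<ge> 3" "n \<noteq> 4"
  obtains a b where "n div 3 = a" "thirds n = {0, a, b}" "0 < a" "2 * a < n"
    "2 * a \<le> b" "2 * b < n + 2 * a" "a + b \<le> n" "n < 2 * b"
proof -
  define m r where "m = n div 3" and "r = n mod 3"
  have n: "n = 3 * m + r" and r: "r = 0 \<or> r = 1 \<or> r = 2" by (auto simp: m_def r_def)
  have third: "n div 3 = m" by (simp add: m_def)
  define b where "b = (if r = 2 then 2 * m + 1 else 2 * m)"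
  have "2 * n div 3 = 2 * m + (2 * r) div 3" by (simp add: n)
  with r have two: "2 * n div 3 = b" by (auto simp: b_def)
  have m: "m \<ge> 1" "\<not> (r = 1 \<and> m = 1)" using assms n r by auto
  show thesis
  proof (rule that[OF third])
    show "thirds n = {0, m, b}" by (simp add: thirds_def third two)
    show "0 < m" using m by simp
    show "2 * m < n" using n m by linarith
    show "2 * m \<le> b" by (simp add: b_def)
    show "2 * b < n + 2 * m" "m + b \<le> n" "n < 2 * b" using n m r by (auto simp: b_def)
  qed
qed

lemma card_thirds:
  assumes "n \<ge> 3" "n \<noteq> 4"
  shows "card (thirds n) = 3"
  by (rule thirds_cases[OF assms]) simp

lemma thirds_subset:
  assumes "n \<ge> 3"
  shows "thirds n \<subseteq> {0..<n}"
  using assms by (auto simp: thirds_def)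

lemma thirds_apart:
  assumes "n \<ge> 3" "n \<noteq> 4" "i \<in> thirds n" "j \<in> thirds n" "i \<noteq> j"
  shows "n div 3 \<le> cyc n i j"
proof -
  obtain a b where a: "n div 3 = a" and th: "thirds n = {0, a, b}"
    and ab: "0 < a" "2 * a < n" "2 * a \<le> b" "2 * b < n + 2 * a" "a + b \<le> n" "n < 2 * b"
    using thirds_cases[OF assms(1,2)] .
  have c: "a \<le> cyc n 0 a" "a \<le> cyc n a b" "a \<le> cyc n 0 b"
    using ab by (simp_all add: cyc_three_short_arcs[of a n b])
  then have "a \<le> cyc n a 0" "a \<le> cyc n b a" "a \<le> cyc n b 0"
    by (simp_all add: cyc_sym[of n a 0] cyc_sym[of n b])
  with c assms(3-5) show ?thesis unfolding a th by auto
qed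

lemma no_between_thirds:
  assumes "n \<ge> 3" "n \<noteq> 4"
  shows "no_between (cyc n) (thirds n)"
proof -
  obtain a b where th: "thirds n = {0, a, b}"
    and ab: "0 < a" "2 * a < n" "2 * a \<le> b" "2 * b < n + 2 * a" "a + b \<le> n" "n < 2 * b"
    using thirds_cases[OF assms] .
  show ?thesis unfolding th using ab by (intro no_between_three_short_arcs) linarith+
qed

text \<open>
  Distances within a level are those of the short cycle, and distances between levels are those of
  the long cycle alone, since levels are at least the diameter of the short cycle apart. A triple on
  one level or on three levels thus reduces to one of the factors. If exactly two points share a
  level, they are equally far from the third one, at a distance \<open>h\<close> of at least \<open>s div 2\<close>. Their own
  distance is positive and at most \<open>s div 2\<close>, so neither \<open>h\<close> nor that distance is a sum of the other
  two.
\<close>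

lemma no_between_torus_Times:
  assumes A: "A \<subseteq> {0..<s}" "no_between (cyc s) A"
    and B: "B \<subseteq> {0..<t}" "no_between (cyc t) B"
    and far: "\<And>i j. i \<in> B \<Longrightarrow> j \<in> B \<Longrightarrow> i \<noteq> j \<Longrightarrow> s div 2 \<le> cyc t i j"
  shows "no_between (torus_dist s t) (A \<times> B)"
  unfolding no_between_def
proof (intro ballI impI)
  fix u v w assume mem: "u \<in> A \<times> B" "v \<in> A \<times> B" "w \<in> A \<times> B" and ne: "u \<noteq> v \<and> w \<noteq> u \<and> w \<noteq> v"
  obtain a a' b b' c c' where p: "u = (a, a')" "v = (b, b')" "w = (c, c')"
    by (cases u, cases v, cases w)
  have level: "torus_dist s t (x, y) (x', y) = cyc s x x'" for x x' y
    by (simp add: torus_dist_def)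
  have across: "torus_dist s t (x, y) (x', y') = cyc t y y'"
    if "y \<in> B" "y' \<in> B" "y \<noteq> y'" for x x' y y'
    using far[OF that] cyc_le_half[of s x x'] by (simp add: torus_dist_def)
  have pos: "cyc s x x' > 0" if "x \<in> A" "x' \<in> A" "x \<noteq> x'" for x x'
    using that A(1) by (intro cyc_pos) auto
  have pos': "cyc t y y' > 0" if "y \<in> B" "y' \<in> B" "y \<noteq> y'" for y y'
    using that B(1) by (intro cyc_pos) auto
  have m: "a \<in> A" "b \<in> A" "c \<in> A" "a' \<in> B" "b' \<in> B" "c' \<in> B" using mem p by auto
  consider "a' = b'" "b' = c'" | "a' = b'" "b' \<noteq> c'" | "a' = c'" "a' \<noteq> b'" | "b' = c'" "a' \<noteq> b'"
    | "a' \<noteq> b'" "b' \<noteq> c'" "a' \<noteq> c'" by blast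
  then show "torus_dist s t u v \<noteq> torus_dist s t u w + torus_dist s t w v"
  proof cases
    case 1
    with ne p have "a \<noteq> b" "c \<noteq> a" "c \<noteq> b" by auto
    with no_betweenD[OF A(2), of a b c] m 1 show ?thesis by (simp add: p level)
  next
    case 2
    have "cyc s a b \<le> cyc t b' c'" using far[of b' c'] m 2 cyc_le_half[of s a b] by simp
    with 2 m pos'[of b' c'] show ?thesis
      by (simp add: p level across cyc_sym[of t c' b'])
  next
    case 3
    with ne p have "c \<noteq> a" by auto
    with 3 m pos[of a c] show ?thesis by (auto simp: p level across)
  next
    case 4
    with ne p have "c \<noteq> b" by auto
    with 4 m pos[of c b] show ?thesis by (auto simp: p level across)
  next
    case 5
    with no_betweenD[OF B(2), of a' b' c'] m show ?thesis by (simp add: p across)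
  qed
qed

theorem theorem4p8:
  fixes s t :: nat
  assumes "s \<ge> 3" and "t \<ge> 3" and "s \<noteq> 4" and "t \<noteq> 4"
    and "t > 15 * (s div 2 - 1)"
  shows "gp_number (strong_product (cycle_graph s) (cycle_graph t)) = 9"
  unfolding gp_number_def
proof (rule Max_eqI)
  let ?G = "strong_product (cycle_graph s) (cycle_graph t)"
  note gp = general_position_torus_iff[OF assms(1,2)]
  have "{S. general_position ?G S} \<subseteq> Pow ({0..<s} \<times> {0..<t})" by (auto simp: gp)
  then have "finite {S. general_position ?G S}" by (rule finite_subset) simp
  then show "finite (card ` {S. general_position ?G S})" by simp
  show "m \<le> 9" if "m \<in> card ` {S. general_position ?G S}" for m
    using that card_le_9_if_no_between[of _ s t] assms(5) by (auto simp: gp)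
  have "s div 2 \<ge> 1" using assms(1) by simp
  with assms(2,5) have "s div 2 * 3 \<le> t" by linarith
  then have "s div 2 \<le> t div 3" by (simp add: less_eq_div_iff_mult_less_eq)
  then have "no_between (torus_dist s t) (thirds s \<times> thirds t)"
    using assms thirds_apart[of t]
    by (intro no_between_torus_Times no_between_thirds thirds_subset) (auto intro: order_trans)
  moreover have "thirds s \<times> thirds t \<subseteq> {0..<s} \<times> {0..<t}"
    using assms by (intro Sigma_mono thirds_subset) auto
  moreover have "card (thirds s \<times> thirds t) = 9"
    using assms by (simp add: card_cartesian_product card_thirds)
  ultimately show "9 \<in> card ` {S. general_position ?G S}"
    by (intro image_eqI[of _ _ "thirds s \<times> thirds t"]) (auto simp: gp)
qed

end
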